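(* Let $k$ be a finite field of order $q=p^n$ ($p$ prime), let $G$ be the affine group of $k$, let $\chi: k\to\mathbb{C}^\times$ be a non-trivial homomorphism from the additive group of $k$, and let $\pi$ be the $(q-1)$-dimensional irreducible unitary representation of $G$ on the space $\mathcal{H}$ of all complex-valued functions on $k^\times$ given by $(\pi(g)F)(a')=\chi(a'b)F(a'a)$ for $g=\iota(b)s(a)$. Let $\mathcal{B}=\{m_\varphi \mid \varphi\in\mathcal{H}\}$ be the algebra of multiplication operators on $\mathcal{H}$, where $m_\varphi(F)=\varphi F$. Then $\mathcal{B}$ is the only maximal $\pi$-inductive algebra.
   Context: $k^\times$ denotes the multiplicative group of non-zero elements of $k$. The affine group of $k$ is the group $G$ of matrices $\begin{bmatrix} a & b\\ 0 & 1\end{bmatrix}$ with $a\in k^\times$, $b\in k$. The homomorphisms $\iota:k\to G$ and $s:k^\times\to G$ are $\iota(b)=\begin{bmatrix}1&b\\0&1\end{bmatrix}$ and $s(a)=\begin{bmatrix}a&0\\0&1\end{bmatrix}$; every $g\in G$ is uniquely of the form $\iota(b)s(a)$. The space $\mathcal{H}$ of complex-valued functions on $k^\times$ carries the inner product $\langle F_1,F_2\rangle=\sum_{a'\in k^\times}F_1(a')\overline{F_2(a')}$. The representation $\pi$ is a realization of $\mathrm{Ind}_{\iota(k)}^G\chi$. A $\pi$-inductive algebra is a (weakly closed) abelian subalgebra $\mathcal{A}$ of the algebra $\mathcal{B}(\mathcal{H})$ of bounded operators on $\mathcal{H}$ such that $\pi(g)\mathcal{A}\pi(g)^{-1}=\mathcal{A}$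 for every $g\in G$ (here $\mathcal{H}$ is finite dimensional, so weak closedness is automatic). A maximal $\pi$-inductive algebra is a maximal element of the set of $\pi$-inductive algebras, partially ordered by inclusion. *)

theory Defs
  imports "HOL-Analysis.Analysis" "HOL-Computational_Algebra.Primes"
begin

typedef (overloaded) 'k nonzero = "{x :: 'k :: field. x \<noteq> 0}"
  morphisms val nonzero
  by (rule exI[of _ 1]) simp

setup_lifting type_definition_nonzero

instantiation nonzero :: (field) comm_monoid_mult
begin

lift_definition one_nonzero :: "'a nonzero" is 1 by simp

lift_definition times_nonzero :: "'a nonzero \<Rightarrow> 'a nonzero \<Rightarrow> 'a nonzero" is "(*)" by simp

instance by standard (transfer; simp add: mult_ac)+

end

instance nonzero :: ("{field, finite}") finite
proof
  have "finite (range (nonzero :: 'a \<Rightarrow> 'a nonzero))"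
    by simp
  moreover have "(UNIV :: 'a nonzero set) \<subseteq> range nonzero"
    by (metis rangeI subsetI val_inverse)
  ultimately show "finite (UNIV :: 'a nonzero set)"
    by (rule rev_finite_subset)
qed

lemma val_mult [simp]: "val (a * b) = val a * val b"
  by transfer simp

lemma val_neq_0 [simp]: "val a \<noteq> 0"
  using val[of a] by simp

text \<open>The affine group, as a group of matrices under \<^term>\<open>(**)\<close>.\<close>

definition affine_mat :: "'k :: field \<Rightarrow> 'k \<Rightarrow> 'k ^ 2 ^ 2" where
  "affine_mat a b = vector [vector [a, b], vector [0, 1]]"

definition affine_group :: "('k :: field ^ 2 ^ 2) set" where
  "affine_group = {affine_mat a b | a b. a \<noteq> 0}"

definition iota :: "'k :: field \<Rightarrow> 'k ^ 2 ^ 2" where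
  "iota b = affine_mat 1 b"

definition scal :: "'k :: field nonzero \<Rightarrow> 'k ^ 2 ^ 2" where
  "scal a = affine_mat (val a) 0"

lemma affine_mat_nth [simp]:
  "affine_mat a b $ 1 $ 1 = a" "affine_mat a b $ 1 $ 2 = b"
  "affine_mat a b $ 2 $ 1 = 0" "affine_mat a b $ 2 $ 2 = 1"
  by (simp_all add: affine_mat_def)

lemma affine_mat_mult: "affine_mat a b ** affine_mat c d = affine_mat (a * c) (a * d + b)"
  by (simp add: vec_eq_iff forall_2 matrix_matrix_mult_def sum_2)

lemma affine_mat_1: "affine_mat 1 0 = mat 1"
  by (simp add: vec_eq_iff forall_2 mat_def)

lemma iota_scal: "iota b ** scal a = affine_mat (val a) b"
  by (simp add: iota_def scal_def affine_mat_mult)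

lemma affine_group_iota_scal: "affine_group = {iota b ** scal a | a b. True}"
proof -
  have "\<exists>a'. affine_mat a b = affine_mat (val a') b" if "a \<noteq> 0" for a b :: 'a
    using that by (metis mem_Collect_eq nonzero_inverse)
  then show ?thesis
    unfolding affine_group_def iota_scal by (force intro: val_neq_0)
qed

lemma affine_group_closed:
  "mat 1 \<in> affine_group"
  "g \<in> affine_group \<Longrightarrow> h \<in> affine_group \<Longrightarrow> g ** h \<in> affine_group"
  "g \<in> affine_group \<Longrightarrow> \<exists>h \<in> affine_group. h ** g = mat 1 \<and> g ** h = mat 1"
proof -
  show "mat 1 \<in> affine_group"
    unfolding affine_group_def affine_mat_1[symmetric] by force
  show "g ** h \<in> affine_group" if "g \<in> affine_group" "h \<in> affine_group"
    using that unfolding affine_group_def by (force simp: affine_mat_mult)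
  show "\<exists>h \<in> affine_group. h ** g = mat 1 \<and> g ** h = mat 1" if *: "g \<in> affine_group"
  proof -
    obtain a b where g: "g = affine_mat a b" "a \<noteq> 0"
      using * unfolding affine_group_def by blast
    have "affine_mat (inverse a) (- (inverse a * b)) \<in> affine_group"
      unfolding affine_group_def using g by force
    then show ?thesis
      by (rule rev_bexI) (use g in \<open>simp add: affine_mat_mult flip: affine_mat_1 mult.assoc\<close>)
  qed
qed

text \<open>
  Operators on a finite-dimensional Hilbert space \<open>complex ^ 'n\<close>. Since
  \<^const>\<open>bounded_linear\<close> only expresses linearity over the reals, homogeneity over the
  complex numbers is required separately.
\<close>

definition cinner_vec :: "complex ^ 'n :: finite \<Rightarrow> complex ^ 'n \<Rightarrow> complex" where
  "cinner_vec F1 F2 = (\<Sum>a\<in>UNIV. F1 $ a * cnj (F2 $ a))"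

lemma cinner_vec_self: "cinner_vec F F = of_real ((norm F)\<^sup>2)"
  by (simp add: cinner_vec_def norm_vec_def L2_set_def real_sqrt_pow2 sum_nonneg
      complex_norm_square flip: of_real_power)

definition bounded_operators :: "(complex ^ 'n :: finite \<Rightarrow> complex ^ 'n) set" where
  "bounded_operators = {T. bounded_linear T \<and> (\<forall>c F. T (c *s F) = c *s T F)}"

definition weak_operator_topology :: "(complex ^ 'n :: finite \<Rightarrow> complex ^ 'n) topology" where
  "weak_operator_topology = topology_generated_by
     {{T \<in> bounded_operators. cinner_vec (T F1) F2 \<in> U} | F1 F2 U. open U}"

lemma topspace_weak_operator_topology: "topspace weak_operator_topology = bounded_operators"
  unfolding weak_operator_topology_def topology_generated_by_topspace
  by (auto intro!: exI[of _ bounded_operators] exI[of _ "UNIV :: complex set"])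

text \<open>Subalgebras are not required to contain the identity operator.\<close>

definition subalgebra :: "(complex ^ 'n :: finite \<Rightarrow> complex ^ 'n) set \<Rightarrow> bool" where
  "subalgebra A \<longleftrightarrow> A \<subseteq> bounded_operators \<and> (\<lambda>_. 0) \<in> A \<and>
     (\<forall>S\<in>A. \<forall>T\<in>A. (\<lambda>F. S F + T F) \<in> A) \<and>
     (\<forall>c. \<forall>T\<in>A. (\<lambda>F. c *s T F) \<in> A) \<and>
     (\<forall>S\<in>A. \<forall>T\<in>A. S \<circ> T \<in> A)"

definition inductive_algebra ::
    "'g set \<Rightarrow> ('g \<Rightarrow> complex ^ 'n :: finite \<Rightarrow> complex ^ 'n) \<Rightarrow>
     (complex ^ 'n \<Rightarrow> complex ^ 'n) set \<Rightarrow> bool" where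
  "inductive_algebra G \<rho> A \<longleftrightarrow> subalgebra A \<and> closedin weak_operator_topology A \<and>
     (\<forall>S\<in>A. \<forall>T\<in>A. S \<circ> T = T \<circ> S) \<and>
     (\<forall>g\<in>G. (\<lambda>T. \<rho> g \<circ> T \<circ> inv (\<rho> g)) ` A = A)"

definition maximal_inductive_algebra ::
    "'g set \<Rightarrow> ('g \<Rightarrow> complex ^ 'n :: finite \<Rightarrow> complex ^ 'n) \<Rightarrow>
     (complex ^ 'n \<Rightarrow> complex ^ 'n) set \<Rightarrow> bool" where
  "maximal_inductive_algebra G \<rho> A \<longleftrightarrow> inductive_algebra G \<rho> A \<and>
     (\<forall>A'. inductive_algebra G \<rho> A' \<and> A \<subseteq> A' \<longrightarrow> A' = A)"

text \<open>
  The character is called \<open>ch\<close> because the letter chi is the binder for vectors.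
\<close>

definition additive_character :: "('k :: field \<Rightarrow> complex) \<Rightarrow> bool" where
  "additive_character ch \<longleftrightarrow> (\<forall>x. ch x \<noteq> 0) \<and> (\<forall>x y. ch (x + y) = ch x * ch y)"

text \<open>
  For \<open>g = iota b ** scal a\<close> the entries of \<open>g\<close> are \<open>g $ 1 $ 1 = val a\<close> and
  \<open>g $ 1 $ 2 = b\<close>; outside \<^const>\<open>affine_group\<close> the value is irrelevant.
\<close>

definition affine_rep ::
    "('k :: {field, finite} \<Rightarrow> complex) \<Rightarrow> 'k ^ 2 ^ 2 \<Rightarrow>
     complex ^ 'k nonzero \<Rightarrow> complex ^ 'k nonzero" where
  "affine_rep ch g F = (\<chi> a'. ch (val a' * g $ 1 $ 2) * F $ (a' * nonzero (g $ 1 $ 1)))"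

lemma affine_rep_iota_scal:
  "affine_rep ch (iota b ** scal a) F $ a' = ch (val a' * b) * F $ (a' * a)"
  by (simp add: affine_rep_def iota_scal val_inverse)

lemma affine_rep_mult:
  assumes "additive_character ch" "g \<in> affine_group" "h \<in> affine_group"
  shows "affine_rep ch (g ** h) = affine_rep ch g \<circ> affine_rep ch h"
proof -
  obtain a b c d where g: "g = iota b ** scal a" and h: "h = iota d ** scal c"
    using assms(2,3) unfolding affine_group_iota_scal by blast
  have gh: "g ** h = iota (val a * d + b) ** scal (a * c)"
    by (simp add: g h iota_scal affine_mat_mult)
  show ?thesis
    unfolding gh using assms(1)
    by (simp add: fun_eq_iff vec_eq_iff affine_rep_iota_scal g h additive_character_def
        algebra_simps)
qed

lemma affine_rep_1:
  assumes "additive_character ch"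
  shows "affine_rep ch (mat 1) = id"
proof -
  have "ch 0 * ch 0 = ch 0 * 1" "ch 0 \<noteq> 0"
    using assms unfolding additive_character_def by (metis add_0 mult_1_right)+
  then have "ch 0 = 1"
    by (metis mult_left_cancel)
  moreover have "mat 1 = iota 0 ** scal (1 :: 'a nonzero)"
    by (simp add: iota_scal one_nonzero.rep_eq affine_mat_1)
  ultimately show ?thesis
    by (metis (no_types, lifting) affine_rep_iota_scal eq_id_iff mult.right_neutral mult_1
        mult_zero_right vec_eq_iff)
qed

lemma bij_affine_rep:
  assumes "additive_character ch" "g \<in> affine_group"
  shows "bij (affine_rep ch g)"
proof -
  obtain h where "h \<in> affine_group" "h ** g = mat 1" "g ** h = mat 1"
    using affine_group_closed(3)[OF assms(2)] by blast
  then show ?thesis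
    using affine_rep_mult[OF assms(1)] affine_rep_1[OF assms(1)] assms(2) by (metis o_bij)
qed

definition mult_op :: "complex ^ 'n :: finite \<Rightarrow> complex ^ 'n \<Rightarrow> complex ^ 'n" where
  "mult_op \<phi> F = (\<chi> a. \<phi> $ a * F $ a)"

definition mult_algebra :: "(complex ^ 'n :: finite \<Rightarrow> complex ^ 'n) set" where
  "mult_algebra = {mult_op \<phi> | \<phi>. True}"

end

theory Submission imports Defs begin

text \<open>
  Write an operator as a matrix \<open>e\<^sub>x\<^sub>y\<close> indexed by \<open>x, y\<close> in the multiplicative group. Conjugation
  by \<open>\<pi>(\<iota>(b))\<close> multiplies \<open>e\<^sub>x\<^sub>y\<close> by \<open>\<chi>((x - y)b)\<close>, and conjugation by \<open>\<pi>(s(a))\<close> replaces it by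
  the entry at \<open>(xa, ya)\<close>. The diagonal matrices are thus invariant, and everything reduces to
  showing that an inductive algebra \<open>A\<close> contains diagonal matrices only.

  Suppose a member of \<open>A\<close> has a nonzero entry at \<open>(x, y)\<close> with \<open>x - y = c \<noteq> 0\<close>. Averaging its
  conjugates under \<open>\<iota>(k)\<close> against a character (\<open>weight_component\<close>) yields a nonzero \<open>P\<close> in \<open>A\<close>
  of weight \<open>c\<close>: all its entries outside the shifted diagonal \<open>x - y = c\<close> vanish. Let \<open>Y\<close> be the
  set of indices \<open>y\<close> of the nonzero columns of \<open>P\<close>. Let \<open>y, z \<in> Y\<close> and let \<open>P'\<close> be the conjugate
  of \<open>P\<close> by \<open>s(a)\<close> with \<open>a = z / (y + c)\<close>. The scaling carries column \<open>y + c\<close> of \<open>P'\<close> to column \<open>z\<close>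
  of \<open>P\<close>, so column \<open>y\<close> of \<open>P' \<circ> P\<close> is nonzero. As \<open>P' \<circ> P = P \<circ> P'\<close>, column \<open>y\<close> of \<open>P'\<close> is
  nonzero as well, that is, \<open>ya = yz / (y + c) \<in> Y\<close> (\<open>column_support_closed\<close>).

  For fixed \<open>z\<close> the map \<open>y \<mapsto> yz / (y + c)\<close> is therefore an injection of the finite set \<open>Y\<close> into
  itself, so it attains the value \<open>z\<close>. That forces \<open>y = y + c\<close>, contradicting \<open>c \<noteq> 0\<close>
  (\<open>weight_operator_eq_0\<close>).
\<close>

section \<open>Matrix entries of operators\<close>

definition entry :: "(complex ^ 'n :: finite \<Rightarrow> complex ^ 'n) \<Rightarrow> 'n \<Rightarrow> 'n \<Rightarrow> complex" where
  "entry T x y = T (axis y 1) $ x"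

lemma bounded_operators_scale: "T \<in> bounded_operators \<Longrightarrow> T (c *s F) = c *s T F"
  by (simp add: bounded_operators_def)

lemma bounded_operators_sum:
  "T \<in> bounded_operators \<Longrightarrow> T (\<Sum>i\<in>I. f i) = (\<Sum>i\<in>I. T (f i))"
  by (simp add: bounded_operators_def bounded_linear.linear linear_sum)

lemma operator_apply:
  assumes "T \<in> bounded_operators"
  shows "T F $ x = (\<Sum>y\<in>UNIV. entry T x y * F $ y)"
proof -
  have "T F = T (\<Sum>y\<in>UNIV. F $ y *s axis y 1)"
    by (simp add: basis_expansion)
  also have "\<dots> = (\<Sum>y\<in>UNIV. F $ y *s T (axis y 1))"
    by (simp add: bounded_operators_sum[OF assms] bounded_operators_scale[OF assms])
  finally show ?thesis
    by (simp add: entry_def mult.commute)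
qed

lemma entry_comp:
  assumes "S \<in> bounded_operators"
  shows "entry (S \<circ> T) x y = (\<Sum>z\<in>UNIV. entry S x z * entry T z y)"
  by (simp add: entry_def[of "S \<circ> T"] entry_def[of T] operator_apply[OF assms])

lemma subalgebra_sum:
  assumes "subalgebra A" "finite I" "\<And>i. i \<in> I \<Longrightarrow> f i \<in> A"
  shows "(\<lambda>F. \<Sum>i\<in>I. f i F) \<in> A"
  using assms(2,3) by (induction I) (use assms(1) in \<open>auto simp: subalgebra_def\<close>)

section \<open>The algebra of multiplication operators\<close>

lemma mult_op_bounded: "mult_op \<phi> \<in> bounded_operators"
proof -
  have "linear (mult_op \<phi>)"
    by (rule linearI) (simp_all add: mult_op_def vec_eq_iff algebra_simps)
  then show ?thesis
    by (simp add: bounded_operators_def linear_conv_bounded_linear[symmetric])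
       (simp add: mult_op_def vec_eq_iff)
qed

lemma mult_algebra_iff_diagonal:
  "T \<in> mult_algebra \<longleftrightarrow> T \<in> bounded_operators \<and> (\<forall>x y. x \<noteq> y \<longrightarrow> entry T x y = 0)"
proof
  assume "T \<in> mult_algebra"
  then show "T \<in> bounded_operators \<and> (\<forall>x y. x \<noteq> y \<longrightarrow> entry T x y = 0)"
    by (auto simp: mult_algebra_def mult_op_bounded entry_def) (simp add: mult_op_def axis_def)
next
  assume *: "T \<in> bounded_operators \<and> (\<forall>x y. x \<noteq> y \<longrightarrow> entry T x y = 0)"
  have "T F = mult_op (\<chi> x. entry T x x) F" for F
  proof -
    have "T F $ x = entry T x x * F $ x" for x
    proof -
      have "T F $ x = (\<Sum>y\<in>UNIV. if y = x then entry T x x * F $ x else 0)"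
        unfolding operator_apply[OF conjunct1[OF *]] by (rule sum.cong) (use * in auto)
      then show ?thesis by simp
    qed
    then show ?thesis
      by (simp add: mult_op_def vec_eq_iff)
  qed
  then show "T \<in> mult_algebra"
    unfolding mult_algebra_def by blast
qed

lemma subalgebra_mult_algebra: "subalgebra mult_algebra"
  unfolding subalgebra_def
proof (intro conjI ballI allI)
  show "mult_algebra \<subseteq> bounded_operators"
    by (auto simp: mult_algebra_iff_diagonal)
  have "(\<lambda>_. 0) = mult_op 0"
    by (simp add: mult_op_def fun_eq_iff vec_eq_iff)
  then show "(\<lambda>_. 0) \<in> mult_algebra"
    unfolding mult_algebra_def by blast
next
  fix S T :: "complex ^ 'n \<Rightarrow> complex ^ 'n"
  assume "S \<in> mult_algebra" "T \<in> mult_algebra"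
  then obtain \<phi> \<psi> where ST: "S = mult_op \<phi>" "T = mult_op \<psi>"
    by (auto simp: mult_algebra_def)
  have "(\<lambda>F. S F + T F) = mult_op (\<phi> + \<psi>)"
    by (simp add: ST mult_op_def fun_eq_iff vec_eq_iff algebra_simps)
  then show "(\<lambda>F. S F + T F) \<in> mult_algebra"
    unfolding mult_algebra_def by blast
  have "S \<circ> T = mult_op (\<chi> x. \<phi> $ x * \<psi> $ x)"
    by (simp add: ST mult_op_def fun_eq_iff vec_eq_iff)
  then show "S \<circ> T \<in> mult_algebra"
    unfolding mult_algebra_def by blast
next
  fix c and T :: "complex ^ 'n \<Rightarrow> complex ^ 'n"
  assume "T \<in> mult_algebra"
  then obtain \<phi> where T: "T = mult_op \<phi>"
    by (auto simp: mult_algebra_def)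
  have "(\<lambda>F. c *s T F) = mult_op (c *s \<phi>)"
    by (simp add: T mult_op_def fun_eq_iff vec_eq_iff)
  then show "(\<lambda>F. c *s T F) \<in> mult_algebra"
    unfolding mult_algebra_def by blast
qed

text \<open>
  Each matrix entry is a coefficient \<open>\<langle>T \<delta>\<^sub>y, \<delta>\<^sub>x\<rangle>\<close> and hence weakly continuous; the algebra is cut
  out by the vanishing of the off-diagonal ones.
\<close>
lemma closedin_mult_algebra: "closedin weak_operator_topology (mult_algebra :: (complex ^ 'n :: finite \<Rightarrow> _) set)"
proof -
  let ?U = "\<lambda>(x :: 'n, y :: 'n). {T \<in> bounded_operators. cinner_vec (T (axis y 1)) (axis x 1) \<in> - {0}}"
  have cinner: "cinner_vec F (axis x 1) = F $ x" for F :: "complex ^ 'n" and x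
  proof -
    have "cinner_vec F (axis x 1) = (\<Sum>a\<in>UNIV. if a = x then F $ x else 0)"
      unfolding cinner_vec_def by (rule sum.cong) (auto simp: axis_def)
    then show ?thesis by simp
  qed
  have "openin weak_operator_topology (?U (x, y))" for x y :: 'n
    unfolding weak_operator_topology_def prod.case
    by (rule topology_generated_by_Basis) blast
  then have "openin weak_operator_topology (\<Union>xy \<in> {(x, y). x \<noteq> y}. ?U xy)"
    by blast
  also have "(\<Union>xy \<in> {(x, y). x \<noteq> y}. ?U xy) = bounded_operators - mult_algebra"
    by (auto simp: mult_algebra_iff_diagonal cinner entry_def)
  finally show ?thesis
    by (auto simp: closedin_def topspace_weak_operator_topology mult_algebra_iff_diagonal)
qed

section \<open>Conjugation by the affine group\<close>

lemma nonzero_divide: "\<exists>a. x * a = (z :: 'k :: field nonzero)"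
proof
  have "val (nonzero (val z / val x)) = val z / val x"
    by (rule nonzero_inverse) simp
  then show "x * nonzero (val z / val x) = z"
    by (simp add: val_inject[symmetric])
qed

lemma nonzero_mult_cancel: "x * a = y * a \<longleftrightarrow> x = (y :: 'k :: field nonzero)"
  by (simp add: val_inject[symmetric])

lemma affine_rep_conj_mult_op:
  assumes "additive_character ch" "g = iota b ** scal a"
  shows "affine_rep ch g \<circ> mult_op \<phi> \<circ> inv (affine_rep ch g) = mult_op (\<chi> x. \<phi> $ (x * a))"
proof -
  have "g \<in> affine_group"
    using assms(2) by (auto simp: affine_group_iota_scal)
  then have bij: "bij (affine_rep ch g)"
    by (rule bij_affine_rep[OF assms(1)])
  have "affine_rep ch g (mult_op \<phi> F) = mult_op (\<chi> x. \<phi> $ (x * a)) (affine_rep ch g F)" for F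
    by (simp add: vec_eq_iff assms(2) affine_rep_iota_scal mult_op_def)
  then show ?thesis
    by (simp add: fun_eq_iff surj_f_inv_f[OF bij_is_surj[OF bij]])
qed

lemma inductive_mult_algebra:
  assumes "additive_character ch"
  shows "inductive_algebra affine_group (affine_rep ch) mult_algebra"
  unfolding inductive_algebra_def
proof (intro conjI ballI)
  fix S T :: "complex ^ 'a nonzero \<Rightarrow> complex ^ 'a nonzero"
  assume "S \<in> mult_algebra" "T \<in> mult_algebra"
  then show "S \<circ> T = T \<circ> S"
    by (auto simp: mult_algebra_def mult_op_def fun_eq_iff vec_eq_iff)
next
  fix g :: "'a ^ 2 ^ 2"
  assume "g \<in> affine_group"
  then obtain a b where g: "g = iota b ** scal a"
    by (auto simp: affine_group_iota_scal)
  note conj = affine_rep_conj_mult_op[OF assms g]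
  show "(\<lambda>T. affine_rep ch g \<circ> T \<circ> inv (affine_rep ch g)) ` mult_algebra = mult_algebra"
  proof (intro subset_antisym subsetI)
    fix T assume "T \<in> (\<lambda>T. affine_rep ch g \<circ> T \<circ> inv (affine_rep ch g)) ` mult_algebra"
    then show "T \<in> mult_algebra"
      unfolding mult_algebra_def using conj by blast
  next
    fix T :: "complex ^ 'a nonzero \<Rightarrow> complex ^ 'a nonzero"
    assume "T \<in> mult_algebra"
    then obtain \<phi> where T: "T = mult_op \<phi>"
      by (auto simp: mult_algebra_def)
    obtain a' where a': "a * a' = 1"
      using nonzero_divide by blast
    \<comment> \<open>Translating the symbol back by the inverse of \<open>a\<close> gives a preimage.\<close>
    have "T = affine_rep ch g \<circ> mult_op (\<chi> x. \<phi> $ (x * a')) \<circ> inv (affine_rep ch g)"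
      unfolding conj T by (simp add: mult.assoc a')
    then show "T \<in> (\<lambda>T. affine_rep ch g \<circ> T \<circ> inv (affine_rep ch g)) ` mult_algebra"
      unfolding mult_algebra_def by blast
  qed
qed (simp_all add: subalgebra_mult_algebra closedin_mult_algebra)

lemma entry_affine_rep_conj:
  assumes "additive_character ch" "g = iota b ** scal a" "T \<in> bounded_operators"
  shows "entry (affine_rep ch g \<circ> T \<circ> inv (affine_rep ch g)) x y =
    ch ((val x - val y) * b) * entry T (x * a) (y * a)"
proof -
  have "g \<in> affine_group"
    using assms(2) by (auto simp: affine_group_iota_scal)
  then have bij: "bij (affine_rep ch g)"
    by (rule bij_affine_rep[OF assms(1)])
  have nz: "ch u \<noteq> 0" and add: "ch (u + v) = ch u * ch v" for u v
    using assms(1) by (auto simp: additive_character_def)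
  have "affine_rep ch g (inverse (ch (val y * b)) *s axis (y * a) 1) = axis y 1"
    by (simp add: vec_eq_iff assms(2) affine_rep_iota_scal axis_def nonzero_mult_cancel nz)
  then have "inv (affine_rep ch g) (axis y 1) = inverse (ch (val y * b)) *s axis (y * a) 1"
    by (metis bij bij_is_inj inv_f_f)
  then have "entry (affine_rep ch g \<circ> T \<circ> inv (affine_rep ch g)) x y =
      ch (val x * b) * (inverse (ch (val y * b)) * entry T (x * a) (y * a))"
    by (simp add: entry_def assms(2) affine_rep_iota_scal bounded_operators_scale[OF assms(3)])
  moreover have "ch (val x * b) = ch ((val x - val y) * b) * ch (val y * b)"
    by (simp add: add[symmetric] algebra_simps)
  ultimately show ?thesis
    by (simp add: nz)
qed

section \<open>Weight components\<close>

text \<open>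
  Shifting the summation variable by some \<open>b\<close> with \<open>\<chi>(db) \<noteq> 1\<close> multiplies the sum by \<open>\<chi>(db)\<close>.
\<close>
lemma additive_character_sum_eq_0:
  fixes ch :: "'k :: {field, finite} \<Rightarrow> complex"
  assumes "additive_character ch" "\<exists>x. ch x \<noteq> 1" "d \<noteq> 0"
  shows "(\<Sum>b\<in>UNIV. ch (d * b)) = 0"
proof -
  obtain x where x: "ch x \<noteq> 1" using assms(2) by blast
  have "(\<Sum>b\<in>UNIV. ch (d * b)) = (\<Sum>b\<in>UNIV. ch (d * (b + x / d)))"
    by (rule sum.reindex_bij_witness[of _ "\<lambda>b. b + x / d" "\<lambda>b. b - x / d"]) auto
  also have "\<dots> = (\<Sum>b\<in>UNIV. ch (d * b)) * ch x"
    using assms(1,3) by (simp add: additive_character_def distrib_left sum_distrib_right)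
  finally show ?thesis
    using x by simp
qed

lemma weight_component:
  fixes ch :: "'k :: {field, finite} \<Rightarrow> complex"
  assumes ch: "additive_character ch" "\<exists>x. ch x \<noteq> 1"
    and A: "inductive_algebra affine_group (affine_rep ch) A" and T: "T \<in> A"
  shows "\<exists>P\<in>A. \<forall>x y. entry P x y = (if val x - val y = c then entry T x y else 0)"
proof -
  have sub: "subalgebra A"
    and conj: "g \<in> affine_group \<Longrightarrow> affine_rep ch g \<circ> T \<circ> inv (affine_rep ch g) \<in> A" for g
    using A T unfolding inductive_algebra_def by blast+
  have scale: "(\<lambda>F. r *s S F) \<in> A" if "S \<in> A" for r S
    using sub that by (simp add: subalgebra_def)
  have Tb: "T \<in> bounded_operators"
    using sub T by (auto simp: subalgebra_def)
  have add: "ch (u + v) = ch u * ch v" for u v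
    using ch(1) by (simp add: additive_character_def)
  have "ch 0 * ch 0 = ch 0" "ch 0 \<noteq> 0"
    using ch(1) by (simp_all add: additive_character_def flip: add)
  then have ch0: "ch 0 = 1" by simp
  define C where "C b = affine_rep ch (iota b ** scal 1) \<circ> T \<circ> inv (affine_rep ch (iota b ** scal 1))"
    for b
  define P where "P F = inverse (of_nat CARD('k)) *s (\<Sum>b\<in>UNIV. ch (- c * b) *s C b F)" for F
  have "C b \<in> A" for b
    unfolding C_def by (rule conj) (auto simp: affine_group_iota_scal)
  then have "P \<in> A"
    unfolding P_def by (intro scale subalgebra_sum[OF sub]) simp_all
  moreover have "entry P x y = (if val x - val y = c then entry T x y else 0)" for x y
  proof -
    have C: "entry (C b) x y = ch ((val x - val y) * b) * entry T x y" for b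
      unfolding C_def by (simp add: entry_affine_rep_conj[OF ch(1) refl Tb])
    have "entry P x y = inverse (of_nat CARD('k)) * (\<Sum>b\<in>UNIV. ch (- c * b) * entry (C b) x y)"
      by (simp add: P_def entry_def)
    also have "(\<Sum>b\<in>UNIV. ch (- c * b) * entry (C b) x y) =
        (\<Sum>b\<in>UNIV. ch ((val x - val y - c) * b)) * entry T x y"
      unfolding C sum_distrib_right mult.assoc[symmetric] add[symmetric]
      by (simp add: algebra_simps)
    finally show ?thesis
      using additive_character_sum_eq_0[OF ch, of "val x - val y - c"]
      by (cases "val x - val y = c") (simp_all add: ch0)
  qed
  ultimately show ?thesis by blast
qed

section \<open>Inductive algebras are diagonal\<close>

text \<open>
  Let \<open>P'\<close> be the conjugate of \<open>P\<close> by \<open>s(a)\<close>. The choice of \<open>a\<close> makes \<open>P'\<close> nonzero on the basis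
  vector to which \<open>P\<close> sends \<open>\<delta>\<^sub>y\<close>, so \<open>P' \<circ> P = P \<circ> P'\<close> does not kill \<open>\<delta>\<^sub>y\<close>, and neither does \<open>P'\<close>.
\<close>
lemma column_support_closed:
  fixes ch :: "'k :: {field, finite} \<Rightarrow> complex"
  assumes ch: "additive_character ch"
    and A: "inductive_algebra affine_group (affine_rep ch) A" and P: "P \<in> A"
    and wt: "\<And>x y. entry P x y \<noteq> 0 \<Longrightarrow> val x = val y + c"
    and y: "entry P x y \<noteq> 0" and z: "entry P w z \<noteq> 0" and a: "x * a = z"
  shows "\<exists>v. entry P v (y * a) \<noteq> 0"
proof -
  define P' where "P' = affine_rep ch (iota 0 ** scal a) \<circ> P \<circ> inv (affine_rep ch (iota 0 ** scal a))"
  have "iota 0 ** scal a \<in> affine_group"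
    by (auto simp: affine_group_iota_scal)
  then have P': "P' \<in> A"
    using A P unfolding inductive_algebra_def P'_def by blast
  have comm: "P' \<circ> P = P \<circ> P'"
    using A P P' by (simp add: inductive_algebra_def)
  have bdd: "P \<in> bounded_operators" "P' \<in> bounded_operators"
    using A P P' by (auto simp: inductive_algebra_def subalgebra_def)
  have nz: "ch 0 \<noteq> 0"
    using ch by (simp add: additive_character_def)
  have P'_entry: "entry P' u v = ch 0 * entry P (u * a) (v * a)" for u v
    unfolding P'_def by (simp add: entry_affine_rep_conj[OF ch refl bdd(1)])
  obtain w' where w': "a * w' = w"
    using nonzero_divide by blast
  \<comment> \<open>A weight operator has at most one nonzero entry in each column.\<close>
  have "entry P v y = 0" if "v \<noteq> x" for v
    using wt y that by (metis val_inject)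
  then have "entry (P' \<circ> P) w' y =
      (\<Sum>v\<in>UNIV. if v = x then entry P' w' x * entry P x y else 0)"
    unfolding entry_comp[OF bdd(2)] by (intro sum.cong) auto
  also have "\<dots> = ch 0 * entry P w z * entry P x y"
    by (simp add: P'_entry a w' mult.commute[of w'])
  also have "\<dots> \<noteq> 0"
    using nz y z by simp
  finally have "(\<Sum>v\<in>UNIV. entry P w' v * entry P' v y) \<noteq> 0"
    unfolding comm entry_comp[OF bdd(1)] .
  then obtain v where "entry P' v y \<noteq> 0"
    by (metis (no_types, lifting) mult_zero_right sum.neutral)
  then show ?thesis
    by (auto simp: P'_entry)
qed

text \<open>
  An injective self-map of a finite set is onto, but \<open>y \<mapsto> yz / (y + c)\<close> never takes the value \<open>z\<close>.
\<close>
lemma weight_operator_eq_0: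
  fixes ch :: "'k :: {field, finite} \<Rightarrow> complex"
  assumes ch: "additive_character ch"
    and A: "inductive_algebra affine_group (affine_rep ch) A" and P: "P \<in> A"
    and wt: "\<And>x y. entry P x y \<noteq> 0 \<Longrightarrow> val x = val y + c" and c: "c \<noteq> 0"
  shows "entry P w z = 0"
proof (rule ccontr)
  assume wz: "entry P w z \<noteq> 0"
  define Y where "Y = {val y | y. \<exists>x. entry P x y \<noteq> 0}"
  define f where "f u = u * val z / (u + c)" for u
  have shift_nz: "u + c \<noteq> 0" if u: "u \<in> Y" for u
  proof -
    obtain x y where xy: "u = val y" "entry P x y \<noteq> 0"
      using u by (auto simp: Y_def)
    have "u + c = val x"
      using wt[OF xy(2)] xy(1) by simp
    then show ?thesis by simp
  qed
  have "f u \<in> Y" if u: "u \<in> Y" for u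
  proof -
    obtain x y where xy: "u = val y" "entry P x y \<noteq> 0"
      using u by (auto simp: Y_def)
    obtain a where a: "x * a = z"
      using nonzero_divide by blast
    have "f u = val (y * a)"
      using shift_nz[OF u] unfolding f_def a[symmetric] by (simp add: xy wt[OF xy(2)])
    then show ?thesis
      using column_support_closed[OF ch A P wt xy(2) wz a] unfolding Y_def by blast
  qed
  moreover have "inj_on f Y"
  proof (rule inj_onI)
    fix u v assume "u \<in> Y" "v \<in> Y" "f u = f v"
    then have "u * (v + c) = v * (u + c)"
      using shift_nz by (simp add: f_def divide_simps)
    then show "u = v"
      using c by (simp add: algebra_simps)
  qed
  ultimately have "f ` Y = Y"
    by (intro endo_inj_surj) auto
  moreover have "val z \<in> Y"
    using wz by (auto simp: Y_def)
  ultimately obtain u where "u \<in> Y" "f u = val z"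
    by (metis imageE)
  then have "u * val z = (u + c) * val z"
    using shift_nz by (simp add: f_def divide_simps mult.commute)
  then show False
    using c by simp
qed

lemma inductive_algebra_subset_mult_algebra:
  fixes ch :: "'k :: {field, finite} \<Rightarrow> complex"
  assumes ch: "additive_character ch" "\<exists>x. ch x \<noteq> 1"
    and A: "inductive_algebra affine_group (affine_rep ch) A"
  shows "A \<subseteq> mult_algebra"
proof
  fix T assume T: "T \<in> A"
  have "entry T x y = 0" if "x \<noteq> y" for x y
  proof -
    obtain P where P: "P \<in> A"
      "\<And>u v. entry P u v = (if val u - val v = val x - val y then entry T u v else 0)"
      using weight_component[OF ch A T, of "val x - val y"] by blast
    have "entry P x y = 0"
    proof (rule weight_operator_eq_0[OF ch(1) A P(1), where c = "val x - val y"])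
      show "val u = val v + (val x - val y)" if "entry P u v \<noteq> 0" for u v
        using that by (auto simp: P(2) algebra_simps split: if_splits)
    qed (use that in \<open>simp add: val_inject\<close>)
    then show ?thesis
      by (simp add: P(2))
  qed
  moreover have "T \<in> bounded_operators"
    using A T by (auto simp: inductive_algebra_def subalgebra_def)
  ultimately show "T \<in> mult_algebra"
    by (simp add: mult_algebra_iff_diagonal)
qed

theorem theorem1:
  fixes ch :: "'k :: {field, finite} \<Rightarrow> complex" and p n :: nat
  assumes "prime p" and "CARD('k) = p ^ n"
    and "additive_character ch" and "\<exists>x. ch x \<noteq> 1"
  shows "{A. maximal_inductive_algebra affine_group (affine_rep ch) A} = {mult_algebra}"
  using inductive_mult_algebra[OF assms(3)] inductive_algebra_subset_mult_algebra[OF assms(3,4)]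
  unfolding maximal_inductive_algebra_def by blast

end
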